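(* For $j\in\mathcal{J}$ let $\mathcal{U}_j:=\{x\in X:\ U_j^{p+1}(\hat{a}_j^{\top}x)\le -x^{\top}a_j^{0}\}$, and let $\overline{X}_j:=\lim_{r\to\infty}X_j^r$ be the limit, with respect to the Hausdorff distance, of the sequence of quantile closures of $X$ associated to row $j$. Then $$\mathcal{U}_j\subseteq\mathrm{conv}(\mathcal{U}_j)=\overline{X}_j .$$
   Context: Data: finite index sets $\mathcal{I}$, $\mathcal{J}$ and $\mathcal{S}=\{1,\dots,|\mathcal{S}|\}$ (equiprobable scenarios); a non-empty compact set $X\subseteq\mathbb{R}^{|\mathcal{I}|}$ (given by deterministic constraints); a risk parameter $\epsilon\in(0,1)$ and $p:=\lfloor\epsilon|\mathcal{S}|\rfloor$; vectors $a_j^0,\hat{a}_j\in\mathbb{R}^{|\mathcal{I}|}$ for $j\in\mathcal{J}$; real numbers $\Omega_{js},b_{js}$ for $j\in\mathcal{J},s\in\mathcal{S}$. Envelope. For $j\in\mathcal{J}$ put $z_j^d=\inf_{x\in X}\hat{a}_j^{\top}x$ and $z_j^u=\sup_{x\in X}\hat{a}_j^{\top}x$. Let $L_{js}$ be the function (line) $f_{js}(z)=\Omega_{js}z-b_{js}$ for $z\in[z_j^d,z_j^u]$, and $\mathcal{L}_j=\{L_{js}:s\in\mathcal{S}\}$. The line $L_{js}$ lies above a point $(\tilde z,\tilde t)$ if $\tilde t<\Omega_{js}\tilde z-b_{js}$ and contains it if $\tilde t=\Omega_{js}\tilde z-b_{js}$; a point belongs to $\mathcal{L}_j$ if some line in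 $\mathcal{L}_j$ contains it. The upper score of a point is the number of lines of $\mathcal{L}_j$ lying above it. The $k$-upper envelope of $\mathcal{L}_j$ is the closure of the set of points that belong to $\mathcal{L}_j$ and have upper score equal to $k-1$; it is regarded as (the graph of) a piecewise linear function of $z$ on $[z_j^d,z_j^u]$, and $U_j^{k}(z)$ denotes its value at $z$. Quantile closures. For $j\in\mathcal{J},s\in\mathcal{S}$ let $\mathcal{X}_{js}=\{x\in\mathbb{R}^{|\mathcal{I}|}:\Omega_{js}\hat{a}_j^{\top}x\le b_{js}-x^{\top}a_j^0\}$, and let $\mathcal{S}^F=\{S'\subseteq\mathcal{S}:|S'|\ge|\mathcal{S}|-p\}$. For $\alpha\in\mathbb{R}^{|\mathcal{I}|}$ and a set $Y\subseteq\mathbb{R}^{|\mathcal{I}|}$ define $\gamma^{\alpha}_{js}(Y)=\min\{\alpha^{\top}x:x\in Y\cap\mathcal{X}_{js}\}$ (with value $+\infty$ if the set is empty) and the quantile $$\gamma^{\alpha}_{jq}(Y)=\min_{S'\in\mathcal{S}^F}\max_{s\in S'}\gamma^{\alpha}_{js}(Y).$$ Put $X_j^0=X$ and, for $r\ge1$, define the $r$-th round quantile closure of $X$ associated to $j$ by $$X_j^r=\bigcap_{\alpha\in\mathbb{R}^{|\mathcal{I}|}}\{x\in\mathbb{R}^{|\mathcal{I}|}:\alpha^{\top}x\ge\gamma^{\alpha}_{jq}(X_j^{r-1})\}.$$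
   Formalization: X is additionally assumed convex (the claim fails for some non-convex compact X), and the (p+1)-upper envelope of row j, with lines counted per scenario, is assumed to be the graph of a function on [z_j^d, z_j^u]. *)

theory Defs
  imports "HOL-Analysis.Analysis"
begin

section \<open>The upper envelope of the lines of a row\<close>

text \<open>
  The definitions in this section concern one row: \<open>ah\<close> is the vector multiplying the uncertain slope (a-hat), and
  \<open>om s\<close>, \<open>b s\<close> are the slope \<open>\<Omega>\<^sub>j\<^sub>s\<close> and the offset \<open>b\<^sub>j\<^sub>s\<close> of scenario \<open>s \<in> {1..N}\<close>.
\<close>

definition z_down :: "real^'i \<Rightarrow> (real^'i) set \<Rightarrow> real" where
  "z_down ah X = (INF x\<in>X. ah \<bullet> x)"

definition z_up :: "real^'i \<Rightarrow> (real^'i) set \<Rightarrow> real" where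
  "z_up ah X = (SUP x\<in>X. ah \<bullet> x)"

definition line :: "(nat \<Rightarrow> real) \<Rightarrow> (nat \<Rightarrow> real) \<Rightarrow> nat \<Rightarrow> real \<Rightarrow> real" where
  "line om b s z = om s * z - b s"

text \<open>
  Lines are counted by their scenario, so that two scenarios with the same line count twice.
\<close>

definition upper_score :: "(nat \<Rightarrow> real) \<Rightarrow> (nat \<Rightarrow> real) \<Rightarrow> nat \<Rightarrow> real \<times> real \<Rightarrow> nat" where
  "upper_score om b N P = card {s \<in> {1..N}. snd P < line om b s (fst P)}"

definition upper_envelope ::
  "(nat \<Rightarrow> real) \<Rightarrow> (nat \<Rightarrow> real) \<Rightarrow> nat \<Rightarrow> real \<Rightarrow> real \<Rightarrow> nat \<Rightarrow> (real \<times> real) set" where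
  "upper_envelope om b N zd zu k =
     closure {P. fst P \<in> {zd..zu} \<and> (\<exists>s\<in>{1..N}. snd P = line om b s (fst P))
                 \<and> upper_score om b N P + 1 = k}"

text \<open>
  The value of the envelope at a point, and the condition under which it is meaningful: the
  envelope is the graph of a function on the interval. For \<open>1 \<le> k \<le> N\<close> it can only fail for
  degenerate data (coinciding lines, or an interval that is a single point); see
  \<open>upper_envelope_is_graph\<close> below.
\<close>

definition is_graph_on :: "(real \<times> real) set \<Rightarrow> real set \<Rightarrow> bool" where
  "is_graph_on G I \<longleftrightarrow> (\<forall>z\<in>I. \<exists>!t. (z, t) \<in> G)"

definition envelope_value ::
  "(nat \<Rightarrow> real) \<Rightarrow> (nat \<Rightarrow> real) \<Rightarrow> nat \<Rightarrow> real \<Rightarrow> real \<Rightarrow> nat \<Rightarrow> real \<Rightarrow> real" where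
  "envelope_value om b N zd zu k z = (THE t. (z, t) \<in> upper_envelope om b N zd zu k)"

definition envelope_set ::
  "real^'i \<Rightarrow> real^'i \<Rightarrow> (nat \<Rightarrow> real) \<Rightarrow> (nat \<Rightarrow> real) \<Rightarrow> nat \<Rightarrow> nat \<Rightarrow> (real^'i) set \<Rightarrow> (real^'i) set"
where
  "envelope_set a0 ah om b N p X =
     {x \<in> X. envelope_value om b N (z_down ah X) (z_up ah X) (p + 1) (ah \<bullet> x) \<le> - (x \<bullet> a0)}"


section \<open>Quantile closures\<close>

definition scenario_set ::
  "real^'i \<Rightarrow> real^'i \<Rightarrow> (nat \<Rightarrow> real) \<Rightarrow> (nat \<Rightarrow> real) \<Rightarrow> nat \<Rightarrow> (real^'i) set" where
  "scenario_set a0 ah om b s = {x. om s * (ah \<bullet> x) \<le> b s - x \<bullet> a0}"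

definition feasible_scenario_sets :: "nat \<Rightarrow> nat \<Rightarrow> nat set set" where
  "feasible_scenario_sets N p = {S'. S' \<subseteq> {1..N} \<and> int (card S') \<ge> int N - int p}"

text \<open>
  In \<open>ereal\<close> the infimum of the empty set is \<open>\<infinity>\<close>; for compact \<open>Y\<close> the infimum is attained
  whenever the set is nonempty.
\<close>

definition scenario_min ::
  "real^'i \<Rightarrow> real^'i \<Rightarrow> (nat \<Rightarrow> real) \<Rightarrow> (nat \<Rightarrow> real) \<Rightarrow> (real^'i) set \<Rightarrow> real^'i \<Rightarrow> nat \<Rightarrow> ereal"
where
  "scenario_min a0 ah om b Y \<alpha> s = (INF x\<in>Y \<inter> scenario_set a0 ah om b s. ereal (\<alpha> \<bullet> x))"

definition quantile ::
  "real^'i \<Rightarrow> real^'i \<Rightarrow> (nat \<Rightarrow> real) \<Rightarrow> (nat \<Rightarrow> real) \<Rightarrow> nat \<Rightarrow> nat \<Rightarrow> (real^'i) set \<Rightarrow> real^'i \<Rightarrow> ereal"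
where
  "quantile a0 ah om b N p Y \<alpha> =
     Min ((\<lambda>S'. Max (scenario_min a0 ah om b Y \<alpha> ` S')) ` feasible_scenario_sets N p)"

primrec quantile_closure ::
  "real^'i \<Rightarrow> real^'i \<Rightarrow> (nat \<Rightarrow> real) \<Rightarrow> (nat \<Rightarrow> real) \<Rightarrow> nat \<Rightarrow> nat \<Rightarrow> (real^'i) set \<Rightarrow> nat \<Rightarrow> (real^'i) set"
where
  "quantile_closure a0 ah om b N p X 0 = X"
| "quantile_closure a0 ah om b N p X (Suc r) =
     (\<Inter>\<alpha>. {x. ereal (\<alpha> \<bullet> x) \<ge> quantile a0 ah om b N p (quantile_closure a0 ah om b N p X r) \<alpha>})"


section \<open>Limits with respect to the Hausdorff distance\<close>

text \<open>
  With values in \<open>ennreal\<close> the empty set has distance \<open>0\<close> to itself and \<open>\<infinity>\<close> to every nonempty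
  set, so a sequence converges to the empty set iff it is eventually empty. Limits are taken
  among compact sets, where they are unique.
\<close>

definition hausdorff_dist :: "'a::metric_space set \<Rightarrow> 'a set \<Rightarrow> ennreal" where
  "hausdorff_dist A B =
     max (SUP a\<in>A. INF b\<in>B. ennreal (dist a b)) (SUP b\<in>B. INF a\<in>A. ennreal (dist a b))"

definition hausdorff_tendsto :: "(nat \<Rightarrow> 'a::metric_space set) \<Rightarrow> 'a set \<Rightarrow> bool" where
  "hausdorff_tendsto A L \<longleftrightarrow> compact L \<and> (\<lambda>r. hausdorff_dist (A r) L) \<longlonglongrightarrow> 0"

definition hausdorff_convergent :: "(nat \<Rightarrow> 'a::metric_space set) \<Rightarrow> bool" where
  "hausdorff_convergent A \<longleftrightarrow> (\<exists>L. hausdorff_tendsto A L)"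

definition hausdorff_lim :: "(nat \<Rightarrow> 'a::metric_space set) \<Rightarrow> 'a set" where
  "hausdorff_lim A = (THE L. hausdorff_tendsto A L)"


section \<open>The envelope of pairwise distinct lines is a graph\<close>

lemma card_ge_iff_subset:
  assumes "finite A"
  shows "k \<le> card {s \<in> A. Q s} \<longleftrightarrow> (\<exists>T\<in>{T. T \<subseteq> A \<and> card T = k}. \<forall>s\<in>T. Q s)"
proof
  assume "k \<le> card {s \<in> A. Q s}"
  then obtain T where "T \<subseteq> {s \<in> A. Q s}" "card T = k"
    by (meson obtain_subset_with_card_n)
  then show "\<exists>T\<in>{T. T \<subseteq> A \<and> card T = k}. \<forall>s\<in>T. Q s" by auto
next
  assume "\<exists>T\<in>{T. T \<subseteq> A \<and> card T = k}. \<forall>s\<in>T. Q s"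
  then obtain T where "T \<subseteq> {s \<in> A. Q s}" "card T = k" by auto
  then show "k \<le> card {s \<in> A. Q s}" using assms
    by (metis (no_types, lifting) card_mono finite_subset mem_Collect_eq subsetI)
qed

lemma upper_envelope_scores:
  assumes "(z, t) \<in> upper_envelope om b N zd zu k"
  shows "upper_score om b N (z, t) < k" and "k \<le> card {s \<in> {1..N}. t \<le> line om b s z}"
proof -
  let ?E = "{P. fst P \<in> {zd..zu} \<and> (\<exists>s\<in>{1..N}. snd P = line om b s (fst P))
                 \<and> upper_score om b N P + 1 = k}"
  have fin: "finite {T. T \<subseteq> {1..N} \<and> card T = k}" by simp
  have cont: "continuous_on UNIV (\<lambda>P::real\<times>real. line om b s (fst P))" for s
    unfolding line_def by (intro continuous_intros)
  have cont': "continuous_on UNIV (\<lambda>P::real\<times>real. snd P)" by (intro continuous_intros)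
  have e1: "{P. k \<le> upper_score om b N P} =
      (\<Union>T\<in>{T. T \<subseteq> {1..N} \<and> card T = k}. \<Inter>s\<in>T. {P. snd P < line om b s (fst P)})"
    unfolding upper_score_def by (subst card_ge_iff_subset) auto
  have "open {P. k \<le> upper_score om b N P}"
    unfolding e1 by (intro open_UN open_INT ballI open_Collect_less cont cont')
      (auto intro: finite_subset)
  then have c1: "closed {P. upper_score om b N P < k}"
    by (simp add: closed_def Compl_eq not_less)
  have e2: "{P. k \<le> card {s \<in> {1..N}. snd P \<le> line om b s (fst P)}} =
      (\<Union>T\<in>{T. T \<subseteq> {1..N} \<and> card T = k}. \<Inter>s\<in>T. {P. snd P \<le> line om b s (fst P)})"
    by (subst card_ge_iff_subset) auto
  have c2: "closed {P. k \<le> card {s \<in> {1..N}. snd P \<le> line om b s (fst P)}}"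
    unfolding e2 by (intro closed_UN closed_INT ballI closed_Collect_le cont cont' fin)
  have s1: "?E \<subseteq> {P. upper_score om b N P < k}" by auto
  have s2: "?E \<subseteq> {P. k \<le> card {s \<in> {1..N}. snd P \<le> line om b s (fst P)}}"
  proof
    fix P assume P: "P \<in> ?E"
    then obtain s where s: "s \<in> {1..N}" "snd P = line om b s (fst P)" by auto
    have "insert s {s \<in> {1..N}. snd P < line om b s (fst P)}
            \<subseteq> {s \<in> {1..N}. snd P \<le> line om b s (fst P)}" using s by auto
    then have "card (insert s {s \<in> {1..N}. snd P < line om b s (fst P)})
            \<le> card {s \<in> {1..N}. snd P \<le> line om b s (fst P)}" by (intro card_mono) auto
    then show "P \<in> {P. k \<le> card {s \<in> {1..N}. snd P \<le> line om b s (fst P)}}"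
      using P s by (auto simp: upper_score_def)
  qed
  have "(z, t) \<in> {P. upper_score om b N P < k}"
    using closure_minimal[OF s1 c1] assms unfolding upper_envelope_def by blast
  then show "upper_score om b N (z, t) < k" by simp
  have "(z, t) \<in> {P. k \<le> card {s \<in> {1..N}. snd P \<le> line om b s (fst P)}}"
    using closure_minimal[OF s2 c2] assms unfolding upper_envelope_def by blast
  then show "k \<le> card {s \<in> {1..N}. t \<le> line om b s z}" by simp
qed

lemma upper_envelope_unique:
  assumes "(z, t1) \<in> upper_envelope om b N zd zu k" "(z, t2) \<in> upper_envelope om b N zd zu k"
  shows "t1 = t2"
proof -
  have "\<not> u < v" if "(z, u) \<in> upper_envelope om b N zd zu k"
    "(z, v) \<in> upper_envelope om b N zd zu k" for u v
  proof
    assume "u < v"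
    then have "{s \<in> {1..N}. v \<le> line om b s z} \<subseteq> {s \<in> {1..N}. u < line om b s z}" by auto
    then have "card {s \<in> {1..N}. v \<le> line om b s z} \<le> card {s \<in> {1..N}. u < line om b s z}"
      by (intro card_mono) auto
    then show False
      using upper_envelope_scores(1)[OF that(1)] upper_envelope_scores(2)[OF that(2)]
      by (simp add: upper_score_def)
  qed
  then show ?thesis using assms by (meson linorder_neqE)
qed

lemma rank_exists:
  fixes g :: "'a \<Rightarrow> real"
  assumes "finite A" "inj_on g A" "k < card A"
  shows "\<exists>s\<in>A. card {u \<in> A. g s < g u} = k"
  using assms
proof (induction k arbitrary: A)
  case 0
  then have "A \<noteq> {}" by auto
  then obtain s where "s \<in> A" "\<forall>u\<in>A. g u \<le> g s"
    using 0(1) Max_in[of "g ` A"] Max_ge[of "g ` A"] by fastforce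
  then have "{u \<in> A. g s < g u} = {}" by force
  then show ?case using \<open>s \<in> A\<close> by (metis card.empty)
next
  case (Suc k)
  then have "A \<noteq> {}" by auto
  then obtain m where m: "m \<in> A" "\<forall>u\<in>A. g u \<le> g m"
    using Suc.prems(1) Max_in[of "g ` A"] Max_ge[of "g ` A"] by fastforce
  have "\<exists>s\<in>A - {m}. card {u \<in> A - {m}. g s < g u} = k"
    using Suc.prems m by (intro Suc.IH) (auto simp: inj_on_diff)
  then obtain s where s: "s \<in> A - {m}" "card {u \<in> A - {m}. g s < g u} = k" by blast
  have "g s \<noteq> g m" using s m Suc.prems by (metis Diff_iff inj_onD singletonI)
  then have "g s < g m" using s m by (metis DiffD1 order_le_less)
  then have "{u \<in> A. g s < g u} = insert m {u \<in> A - {m}. g s < g u}" using m by auto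
  then have "card {u \<in> A. g s < g u} = Suc k" using s Suc.prems by simp
  then show ?case using s by blast
qed

lemma upper_envelope_is_graph:
  assumes "zd < zu" and "1 \<le> k" "k \<le> N"
    and inj: "inj_on (\<lambda>s. (om s, b s)) {1..N}"
  shows "is_graph_on (upper_envelope om b N zd zu k) {zd..zu}"
proof -
  define E where "E = {P. fst P \<in> {zd..zu} \<and> (\<exists>s\<in>{1..N}. snd P = line om b s (fst P))
                 \<and> upper_score om b N P + 1 = k}"
  define C where "C = (\<Union>s\<in>{1..N}. \<Union>u\<in>{1..N} - {s}. {z. line om b s z = line om b u z})"
  have "finite {z. line om b s z = line om b u z}"
    if "s \<in> {1..N}" "u \<in> {1..N} - {s}" for s u
  proof (cases "om s = om u")
    case True
    then have "b s \<noteq> b u" using that inj by (auto dest: inj_onD)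
    then have "{z. line om b s z = line om b u z} = {}" using True by (auto simp: line_def)
    then show ?thesis by simp
  next
    case False
    then have "{z. line om b s z = line om b u z} \<subseteq> {(b s - b u) / (om s - om u)}"
      by (auto simp: line_def field_simps)
    then show ?thesis using finite_subset by blast
  qed
  then have finC: "finite C" unfolding C_def by auto
  have sub: "{zd<..<zu} - C \<subseteq> fst ` E"
  proof
    fix z assume z: "z \<in> {zd<..<zu} - C"
    have "inj_on (\<lambda>s. line om b s z) {1..N}" using z unfolding C_def inj_on_def by auto
    moreover have "k - 1 < card {1..N}" using assms by simp
    ultimately obtain s
      where "s \<in> {1..N}" "card {u \<in> {1..N}. line om b s z < line om b u z} = k - 1"
      using rank_exists[of "{1..N}" "\<lambda>s. line om b s z" "k - 1"] by blast
    then have "(z, line om b s z) \<in> E" using z assms by (auto simp: E_def upper_score_def)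
    then show "z \<in> fst ` E" by force
  qed
  have "bounded E"
  proof -
    have "E \<subseteq> (\<Union>s\<in>{1..N}. (\<lambda>z. (z, line om b s z)) ` {zd..zu})"
      unfolding E_def by force
    moreover have "bounded (\<Union>s\<in>{1..N}. (\<lambda>z. (z, line om b s z)) ` {zd..zu})"
      unfolding line_def
      by (intro bounded_UN ballI compact_imp_bounded compact_continuous_image continuous_intros)
        auto
    ultimately show ?thesis using bounded_subset by blast
  qed
  then have "compact (fst ` closure E)"
    by (intro compact_continuous_image continuous_intros) (simp add: compact_closure)
  then have cl: "closed (fst ` closure E)" by (rule compact_imp_closed)
  have "{zd<..<zu} - C \<subseteq> fst ` closure E"
    using sub closure_subset by blast
  then have c1: "closure ({zd<..<zu} - C) \<subseteq> fst ` closure E" using cl by (rule closure_minimal)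
  have c2: "closure ({zd<..<zu} - C) = {zd..zu}"
  proof -
    have "{zd<..<zu} \<subseteq> closure ({zd<..<zu} - C)"
    proof
      fix z assume z: "z \<in> {zd<..<zu}"
      show "z \<in> closure ({zd<..<zu} - C)"
      proof (rule ccontr)
        assume "z \<notin> closure ({zd<..<zu} - C)"
        then have ne: "{zd<..<zu} - closure ({zd<..<zu} - C) \<noteq> {}" using z by blast
        have "open ({zd<..<zu} - closure ({zd<..<zu} - C))" by (simp add: open_Diff)
        then have "infinite ({zd<..<zu} - closure ({zd<..<zu} - C))"
          using ne finite_imp_not_open by metis
        moreover have "{zd<..<zu} - closure ({zd<..<zu} - C) \<subseteq> C"
          using closure_subset[of "{zd<..<zu} - C"] by auto
        ultimately show False using finite_subset[OF _ finC] by auto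
      qed
    qed
    then have "closure {zd<..<zu} \<subseteq> closure ({zd<..<zu} - C)"
      by (simp add: closure_minimal)
    moreover have "closure ({zd<..<zu} - C) \<subseteq> closure {zd<..<zu}" by (intro closure_mono) auto
    ultimately show ?thesis using \<open>zd < zu\<close> by (metis closure_greaterThanLessThan subset_antisym)
  qed
  have "\<exists>t. (z, t) \<in> closure E" if "z \<in> {zd..zu}" for z
  proof -
    have "z \<in> fst ` closure E" using that c1 c2 by auto
    then show ?thesis by force
  qed
  then have "\<exists>t. (z, t) \<in> upper_envelope om b N zd zu k" if "z \<in> {zd..zu}" for z
    using that unfolding upper_envelope_def E_def by simp
  then show ?thesis
    unfolding is_graph_on_def by (intro ballI ex_ex1I) (auto intro: upper_envelope_unique)
qed

end

(* The set U consists of the points of X satisfying at least N - p scenario inequalities: if t is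
   the value of the (p+1)-envelope at z, at most p lines lie strictly above (z, t) and at least p + 1
   weakly above it. Every closure contains U, and the closures are nested compact convex sets, so
   they converge to their intersection L, which by compactness is a fixed point of the quantile
   closure. A point of L at maximal distance from a given centre is the only minimiser over L of
   some linear functional, so the fixed-point property puts it in U. If L had a point outside
   conv U, some ball would contain U but not that point, and the point of L farthest from its
   centre would contradict this. *)
theory Submission
  imports Defs
begin

section \<open>Hausdorff limits of compact sets\<close>

lemma hausdorff_dist_less_left:
  assumes "hausdorff_dist A B < ennreal e" "a \<in> A"
  obtains b where "b \<in> B" "dist a b < e"
proof -
  have "(INF b\<in>B. ennreal (dist a b)) \<le> (SUP a\<in>A. INF b\<in>B. ennreal (dist a b))"
    using assms(2) by (rule SUP_upper)
  also have "\<dots> < ennreal e"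
    using assms(1) unfolding hausdorff_dist_def by simp
  finally obtain b where "b \<in> B" "ennreal (dist a b) < ennreal e"
    unfolding INF_less_iff by blast
  then show thesis using that by (auto simp: ennreal_less_iff)
qed

lemma hausdorff_dist_commute: "hausdorff_dist A B = hausdorff_dist B A"
  unfolding hausdorff_dist_def by (simp add: dist_commute max.commute)

text \<open>For large \<open>r\<close>, points of \<open>L\<close> are close to points of
  \<open>A r\<close>, and these to points of \<open>M\<close>; closedness of \<open>M\<close> does
  the rest. Used in both directions it gives uniqueness of limits, which justifies the
  \<open>THE\<close> in \<open>hausdorff_lim\<close>.\<close>

lemma hausdorff_tendsto_subset:
  assumes "hausdorff_tendsto A L" "hausdorff_tendsto A M"
  shows "L \<subseteq> M"
proof
  fix l assume l: "l \<in> L"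
  have "\<exists>m\<in>M. dist m l < e" if e: "0 < e" for e
  proof -
    have e2: "0 < ennreal (e / 2)" using e by simp
    have "\<forall>\<^sub>F r in sequentially. hausdorff_dist (A r) L < ennreal (e / 2)"
      using assms(1) e2 order_tendstoD(2) unfolding hausdorff_tendsto_def by blast
    moreover have "\<forall>\<^sub>F r in sequentially. hausdorff_dist (A r) M < ennreal (e / 2)"
      using assms(2) e2 order_tendstoD(2) unfolding hausdorff_tendsto_def by blast
    ultimately obtain r where r: "hausdorff_dist (A r) L < ennreal (e / 2)"
      "hausdorff_dist (A r) M < ennreal (e / 2)"
      using eventually_happens'[OF sequentially_bot eventually_conj] by blast
    obtain a where a: "a \<in> A r" "dist l a < e / 2"
      using hausdorff_dist_less_left[of L "A r"] r(1) l by (metis hausdorff_dist_commute)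
    obtain m where "m \<in> M" "dist a m < e / 2"
      using hausdorff_dist_less_left[OF r(2) a(1)] by blast
    then show ?thesis
      using a(2) dist_triangle[of m l a] by (auto simp: dist_commute intro!: bexI[of _ m])
  qed
  then have "l \<in> closure M" by (simp add: closure_approachable)
  then show "l \<in> M"
    using assms(2) by (simp add: hausdorff_tendsto_def compact_imp_closed)
qed

lemma hausdorff_lim_eq:
  assumes "hausdorff_tendsto A L"
  shows "hausdorff_lim A = L"
  unfolding hausdorff_lim_def
  using assms by (rule the_equality) (meson assms antisym hausdorff_tendsto_subset)

text \<open>Otherwise the sets \<open>A r - W\<close> are nested, nonempty and compact, hence share
  a point.\<close>

lemma nested_compact_subset_open:
  fixes A :: "nat \<Rightarrow> 'a::heine_borel set"
  assumes "\<And>r. compact (A r)" "decseq A" "open W" "(\<Inter>r. A r) \<subseteq> W"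
  shows "\<exists>r. A r \<subseteq> W"
proof (rule ccontr)
  assume "\<nexists>r. A r \<subseteq> W"
  then have "(\<Inter>r. A r - W) \<noteq> {}"
    using assms by (intro compact_nest compact_diff) (auto dest: decseqD)
  then show False using assms(4) by auto
qed

text \<open>The intersection lies in every \<open>A r\<close>, so only distances from
  \<open>A r\<close> to it matter, and its open \<open>e\<close>-neighbourhood contains some
  \<open>A n\<close>. If the intersection is empty, so is this neighbourhood, and the sets are
  eventually empty.\<close>

lemma hausdorff_tendsto_nested_compact:
  fixes A :: "nat \<Rightarrow> 'a::heine_borel set"
  assumes comp: "\<And>r. compact (A r)" and dec: "decseq A"
  shows "hausdorff_tendsto A (\<Inter>r. A r)"
  unfolding hausdorff_tendsto_def
proof
  let ?L = "\<Inter>r. A r"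
  show "compact ?L" using comp by (intro compact_Inter) auto
  have bound: "\<forall>\<^sub>F r in sequentially. hausdorff_dist (A r) ?L \<le> ennreal e" if e: "0 < e" for e
  proof -
    have "?L \<subseteq> (\<Union>l\<in>?L. ball l e)" using e by force
    then obtain n where n: "A n \<subseteq> (\<Union>l\<in>?L. ball l e)"
      using nested_compact_subset_open[OF comp dec, of "\<Union>l\<in>?L. ball l e"] by blast
    have "hausdorff_dist (A r) ?L \<le> ennreal e" if "n \<le> r" for r
      unfolding hausdorff_dist_def
    proof (intro max.boundedI SUP_least)
      fix a assume "a \<in> A r"
      then have "a \<in> A n" using decseqD[OF dec \<open>n \<le> r\<close>] by blast
      then obtain l where "l \<in> ?L" "dist l a < e" using n by auto
      then show "(INF b\<in>?L. ennreal (dist a b)) \<le> ennreal e"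
        by (intro INF_lower2[of l]) (auto simp: dist_commute intro: ennreal_leI)
    next
      fix l assume "l \<in> ?L"
      then show "(INF a\<in>A r. ennreal (dist a l)) \<le> ennreal e"
        by (intro INF_lower2[of l]) auto
    qed
    then show ?thesis by (auto simp: eventually_sequentially)
  qed
  show "(\<lambda>r. hausdorff_dist (A r) ?L) \<longlonglongrightarrow> 0"
  proof (rule order_tendstoI)
    fix y :: ennreal assume "0 < y"
    \<comment> \<open>Going strictly below \<open>y\<close> makes \<open>q\<close> finite even for
      \<open>y = \<infinity>\<close>, and turns the weak bound into a strict one.\<close>
    then obtain q where q: "0 < q" "q < y" using dense by blast
    then obtain e where e: "q = ennreal e" "0 < e"
      by (cases q) (auto simp: top.not_eq_extremum dest: order.strict_trans1[OF top_greatest])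
    show "\<forall>\<^sub>F r in sequentially. hausdorff_dist (A r) ?L < y"
      using bound[OF e(2)] by eventually_elim (use q e in auto)
  qed auto
qed

section \<open>Farthest points\<close>

text \<open>Expanding around \<open>y\<close>, the squared distance from \<open>c\<close> to
  \<open>w\<close> exceeds that to \<open>y\<close> by at least the squared norm of
  \<open>w - y\<close>. Hence a point \<open>y\<close> of a set farthest from \<open>c\<close> is
  the only minimiser there of the functional \<open>c - y\<close>.\<close>

lemma farthest_point_unique_minimiser:
  fixes c y w :: "'a::real_inner"
  assumes "dist c w \<le> dist c y" "(c - y) \<bullet> w \<le> (c - y) \<bullet> y"
  shows "w = y"
proof -
  have "(norm (c - w))\<^sup>2 \<le> (norm (c - y))\<^sup>2"
    using assms(1) by (simp add: dist_norm)
  moreover have "(norm (c - w))\<^sup>2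
      = (norm (c - y))\<^sup>2 + (norm (w - y))\<^sup>2 - 2 * ((c - y) \<bullet> w - (c - y) \<bullet> y)"
    unfolding power2_norm_eq_inner by (simp add: algebra_simps inner_commute)
  moreover have "(c - y) \<bullet> w - (c - y) \<bullet> y \<le> 0" using assms(2) by (rule iffD2[OF diff_le_0_iff_le])
  ultimately have "(norm (w - y))\<^sup>2 \<le> 0" by argo
  then show ?thesis by simp
qed

text \<open>A large ball looks like a halfspace: the centre is pushed from \<open>x\<close> along
  the normal of a separating hyperplane, towards the side of \<open>C\<close>.\<close>

lemma ball_separating_point_from_convex_compact:
  fixes C :: "'a::euclidean_space set"
  assumes "convex C" "compact C" "x \<notin> C"
  obtains c where "\<And>u. u \<in> C \<Longrightarrow> dist c u < dist c x"
proof -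
  obtain a d where a: "a \<bullet> x < d" "\<And>u. u \<in> C \<Longrightarrow> d < a \<bullet> u"
    using separating_hyperplane_closed_point[OF assms(1) compact_imp_closed[OF assms(2)] assms(3)]
    by blast
  obtain M where M: "\<And>u. u \<in> C \<Longrightarrow> dist x u \<le> M"
    using compact_imp_bounded[OF assms(2)] bounded_any_center[of C x] by blast
  define \<delta> where "\<delta> = d - a \<bullet> x"
  \<comment> \<open>Chosen so that the gain \<open>2 * t * \<delta>\<close> guaranteed by the
    hyperplane exceeds \<open>M\<^sup>2\<close>, a bound on squared distances from \<open>x\<close>
    to points of \<open>C\<close>.\<close>
  define t where "t = (M\<^sup>2 + 1) / (2 * \<delta>)"
  have \<delta>: "0 < \<delta>" using a(1) by (simp add: \<delta>_def)
  then have t: "0 < t" "2 * t * \<delta> = M\<^sup>2 + 1"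
    by (auto simp: t_def add_nonneg_pos)
  have "dist (x + t *\<^sub>R a) u < dist (x + t *\<^sub>R a) x" if u: "u \<in> C" for u
  proof -
    have "(norm (u - x))\<^sup>2 \<le> M\<^sup>2"
      using M[OF u] by (intro power_mono) (auto simp: dist_norm norm_minus_commute)
    moreover have "2 * t * \<delta> \<le> 2 * t * (a \<bullet> u - a \<bullet> x)"
      using a(2)[OF u] t(1) by (intro mult_left_mono) (auto simp: \<delta>_def)
    ultimately have "(norm (u - x))\<^sup>2 < 2 * t * (a \<bullet> u - a \<bullet> x)" using t(2) by linarith
    moreover have "(norm (x + t *\<^sub>R a - u))\<^sup>2
        = (norm (u - x))\<^sup>2 - 2 * t * (a \<bullet> u - a \<bullet> x) + (norm (t *\<^sub>R a))\<^sup>2"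
      unfolding power2_norm_eq_inner by (simp add: algebra_simps inner_commute)
    ultimately have "(norm (x + t *\<^sub>R a - u))\<^sup>2 < (norm (x + t *\<^sub>R a - x))\<^sup>2" by simp
    then show ?thesis unfolding dist_norm by (rule power2_less_imp_less) simp
  qed
  then show thesis by (rule that)
qed

section \<open>Quantile closures\<close>

lemma closed_scenario_set: "closed (scenario_set a0 ah om b s)"
  unfolding scenario_set_def by (intro closed_Collect_le continuous_intros)

lemma finite_feasible_scenario_sets: "finite (feasible_scenario_sets N p)"
  unfolding feasible_scenario_sets_def by simp

lemma all_in_feasible_scenario_sets: "{1..N} \<in> feasible_scenario_sets N p"
  unfolding feasible_scenario_sets_def by simp

text \<open>Because \<open>p < N\<close>, the \<open>Max\<close> in \<open>quantile\<close> is
  always a genuine maximum.\<close>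

lemma feasible_scenario_setD:
  assumes "S \<in> feasible_scenario_sets N p" "p < N"
  shows "finite S" "S \<noteq> {}"
  using assms unfolding feasible_scenario_sets_def by (auto intro: finite_subset)

text \<open>Compactness makes the infimum attained, and the empty set has infimum
  \<open>\<infinity>\<close>, which is below no real; inequalities in \<open>ereal\<close> thus
  become existence of points.\<close>

lemma scenario_min_le_iff:
  assumes "compact Y"
  shows "scenario_min a0 ah om b Y \<alpha> s \<le> ereal c
           \<longleftrightarrow> (\<exists>y\<in>Y \<inter> scenario_set a0 ah om b s. \<alpha> \<bullet> y \<le> c)"
proof
  let ?K = "Y \<inter> scenario_set a0 ah om b s"
  assume le: "scenario_min a0 ah om b Y \<alpha> s \<le> ereal c"
  have "?K \<noteq> {}"
  proof
    assume "?K = {}"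
    then show False using le unfolding scenario_min_def by (simp add: top_ereal_def)
  qed
  moreover have "compact ?K" using assms closed_scenario_set by (rule compact_Int_closed)
  moreover have "continuous_on ?K (\<lambda>y. \<alpha> \<bullet> y)" by (intro continuous_intros)
  ultimately obtain y where y: "y \<in> ?K" "\<forall>x\<in>?K. \<alpha> \<bullet> y \<le> \<alpha> \<bullet> x"
    using continuous_attains_inf by metis
  then have "ereal (\<alpha> \<bullet> y) \<le> scenario_min a0 ah om b Y \<alpha> s"
    unfolding scenario_min_def by (intro INF_greatest) auto
  with le have "ereal (\<alpha> \<bullet> y) \<le> ereal c" by (rule order_trans[rotated])
  then show "\<exists>y\<in>?K. \<alpha> \<bullet> y \<le> c" using y(1) by auto
next
  assume "\<exists>y\<in>Y \<inter> scenario_set a0 ah om b s. \<alpha> \<bullet> y \<le> c"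
  then show "scenario_min a0 ah om b Y \<alpha> s \<le> ereal c"
    unfolding scenario_min_def by (auto intro: INF_lower2)
qed

lemma quantile_le_iff:
  assumes "compact Y" "p < N"
  shows "quantile a0 ah om b N p Y \<alpha> \<le> ereal c
           \<longleftrightarrow> (\<exists>S\<in>feasible_scenario_sets N p. \<forall>s\<in>S.
                 \<exists>y\<in>Y \<inter> scenario_set a0 ah om b s. \<alpha> \<bullet> y \<le> c)"
proof -
  have "Max (scenario_min a0 ah om b Y \<alpha> ` S) \<le> ereal c
          \<longleftrightarrow> (\<forall>s\<in>S. \<exists>y\<in>Y \<inter> scenario_set a0 ah om b s. \<alpha> \<bullet> y \<le> c)"
    if "S \<in> feasible_scenario_sets N p" for S
    using feasible_scenario_setD[OF that assms(2)] scenario_min_le_iff[OF assms(1)] by simp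
  then show ?thesis
    unfolding quantile_def
    using finite_feasible_scenario_sets[of N p] all_in_feasible_scenario_sets[of N p]
    by (subst Min_le_iff) auto
qed

text \<open>The common form of the envelope set and of the generators of the limit. Here one point
  satisfies all constraints of \<open>S\<close>, whereas in \<open>quantile_le_iff\<close> the point
  may vary with \<open>s\<close>.\<close>

definition quantile_feasible ::
  "real^'i \<Rightarrow> real^'i \<Rightarrow> (nat \<Rightarrow> real) \<Rightarrow> (nat \<Rightarrow> real) \<Rightarrow> nat \<Rightarrow> nat \<Rightarrow> (real^'i) set \<Rightarrow> (real^'i) set"
where
  "quantile_feasible a0 ah om b N p X =
     X \<inter> (\<Union>S\<in>feasible_scenario_sets N p. \<Inter>s\<in>S. scenario_set a0 ah om b s)"

lemma compact_quantile_feasible: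
  assumes "compact X"
  shows "compact (quantile_feasible a0 ah om b N p X)"
  unfolding quantile_feasible_def
  by (intro compact_Int_closed[OF assms] closed_UN closed_INT ballI closed_scenario_set
      finite_feasible_scenario_sets)

section \<open>The rounds of closure of a compact convex set and their limit\<close>

locale quantile_row =
  fixes a0 ah :: "real^'i" and om b :: "nat \<Rightarrow> real" and N p :: nat and X :: "(real^'i) set"
  assumes compact_X: "compact X" and convex_X: "convex X" and p_less_N: "p < N"
begin

abbreviation "clo \<equiv> quantile_closure a0 ah om b N p X"
abbreviation "feas \<equiv> quantile_feasible a0 ah om b N p X"
abbreviation "scen \<equiv> scenario_set a0 ah om b"

declare quantile_closure.simps(2) [simp del]

text \<open>The normal of a hyperplane cutting a point off round \<open>r\<close> is itself a valid
  \<open>\<alpha>\<close>, and its quantile cut removes that point. The assumptions on round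
  \<open>r\<close> are discharged later, in an induction that uses this inclusion.\<close>

lemma closure_Suc_subset_if:
  assumes "compact (clo r)" "convex (clo r)"
  shows "clo (Suc r) \<subseteq> clo r"
proof (rule ccontr)
  assume "\<not> clo (Suc r) \<subseteq> clo r"
  then obtain x where x: "x \<in> clo (Suc r)" "x \<notin> clo r" by blast
  obtain a d where a: "a \<bullet> x < d" "\<And>y. y \<in> clo r \<Longrightarrow> d < a \<bullet> y"
    using separating_hyperplane_closed_point[OF assms(2) compact_imp_closed[OF assms(1)] x(2)]
    by blast
  have "quantile a0 ah om b N p (clo r) a \<le> ereal (a \<bullet> x)"
    using x(1) by (auto simp: quantile_closure.simps(2))
  then obtain S where S: "S \<in> feasible_scenario_sets N p"
    "\<forall>s\<in>S. \<exists>y\<in>clo r \<inter> scen s. a \<bullet> y \<le> a \<bullet> x"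
    unfolding quantile_le_iff[OF assms(1) p_less_N] by blast
  then obtain y where "y \<in> clo r" "a \<bullet> y \<le> a \<bullet> x"
    using feasible_scenario_setD(2)[OF S(1) p_less_N] by blast
  then show False using a by fastforce
qed

lemma closed_convex_closure_Suc: "closed (clo (Suc r)) \<and> convex (clo (Suc r))"
proof -
  \<comment> \<open>The alternatives correspond to a finite threshold, \<open>-\<infinity>\<close>
    and \<open>\<infinity>\<close>.\<close>
  have "{x. q \<le> ereal (\<alpha> \<bullet> x)} = {x. real_of_ereal q \<le> \<alpha> \<bullet> x}
      \<or> {x. q \<le> ereal (\<alpha> \<bullet> x)} = UNIV \<or> {x. q \<le> ereal (\<alpha> \<bullet> x)} = {}" for q and \<alpha> :: "real^'i"
    by (cases q) auto
  then have "closed {x. q \<le> ereal (\<alpha> \<bullet> x)} \<and> convex {x. q \<le> ereal (\<alpha> \<bullet> x)}"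
    for q and \<alpha> :: "real^'i"
    by (metis closed_UNIV closed_empty closed_halfspace_ge convex_UNIV convex_empty
        convex_halfspace_ge)
  then show ?thesis
    unfolding quantile_closure.simps(2) by (intro conjI closed_INT convex_INT ballI) auto
qed

lemma compact_convex_closure: "compact (clo r) \<and> convex (clo r)"
proof (induction r)
  case 0
  show ?case by (simp add: compact_X convex_X)
next
  case (Suc r)
  \<comment> \<open>By nestedness this intersection is \<open>clo (Suc r)\<close> itself, which
    inherits boundedness.\<close>
  then have "compact (clo r \<inter> clo (Suc r))"
    using closed_convex_closure_Suc by (blast intro: compact_Int_closed)
  then show ?case
    using closure_Suc_subset_if Suc closed_convex_closure_Suc by (metis inf.absorb2)
qed

lemma decseq_closure: "decseq clo"
  using closure_Suc_subset_if compact_convex_closure by (blast intro: decseq_SucI)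

lemma mem_closure_Suc_iff:
  "x \<in> clo (Suc r) \<longleftrightarrow>
     (\<forall>\<alpha>. \<exists>S\<in>feasible_scenario_sets N p. \<forall>s\<in>S. \<exists>y\<in>clo r \<inter> scen s. \<alpha> \<bullet> y \<le> \<alpha> \<bullet> x)"
proof -
  have "compact (clo r)" using compact_convex_closure by blast
  then show ?thesis
    unfolding quantile_closure.simps(2) by (simp add: quantile_le_iff[OF _ p_less_N])
qed

text \<open>Such a point is its own witness \<open>y\<close> for every \<open>\<alpha>\<close> and
  every \<open>s\<close> in its set \<open>S\<close>.\<close>

lemma feasible_subset_closure: "feas \<subseteq> clo r"
proof (induction r)
  case 0
  show ?case by (simp add: quantile_feasible_def)
next
  case (Suc r)
  show ?case
  proof
    fix x assume x: "x \<in> feas"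
    then obtain S where "S \<in> feasible_scenario_sets N p" "\<forall>s\<in>S. x \<in> scen s"
      unfolding quantile_feasible_def by auto
    then show "x \<in> clo (Suc r)"
      unfolding mem_closure_Suc_iff using Suc x by blast
  qed
qed

text \<open>Each round supplies its own \<open>S\<close>, but there are only finitely many choices,
  so one recurs infinitely often; for it, the nested compact witness sets have a common
  point.\<close>

lemma limit_fixed_point:
  assumes "x \<in> (\<Inter>r. clo r)"
  shows "\<exists>S\<in>feasible_scenario_sets N p. \<forall>s\<in>S. \<exists>y\<in>(\<Inter>r. clo r) \<inter> scen s. \<alpha> \<bullet> y \<le> \<alpha> \<bullet> x"
proof -
  define W where "W r s = clo r \<inter> scen s \<inter> {y. \<alpha> \<bullet> y \<le> \<alpha> \<bullet> x}" for r s
  have "\<exists>S\<in>feasible_scenario_sets N p. \<forall>s\<in>S. W r s \<noteq> {}" for r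
  proof -
    have "x \<in> clo (Suc r)" using assms by blast
    then obtain S where "S \<in> feasible_scenario_sets N p"
      "\<forall>s\<in>S. \<exists>y\<in>clo r \<inter> scen s. \<alpha> \<bullet> y \<le> \<alpha> \<bullet> x"
      unfolding mem_closure_Suc_iff by blast
    then show ?thesis unfolding W_def by blast
  qed
  then obtain f where f: "\<And>r. f r \<in> feasible_scenario_sets N p" "\<And>r s. s \<in> f r \<Longrightarrow> W r s \<noteq> {}"
    by metis
  have "finite (range f)"
    using f(1) finite_feasible_scenario_sets by (meson finite_subset image_subsetI)
  then obtain r0 where inf: "infinite {r. f r = f r0}"
    using pigeonhole_infinite[of "UNIV :: nat set" f] by auto
  have "\<exists>y\<in>(\<Inter>r. clo r) \<inter> scen s. \<alpha> \<bullet> y \<le> \<alpha> \<bullet> x" if s: "s \<in> f r0" for s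
  proof -
    have mono: "W n s \<subseteq> W m s" if "m \<le> n" for m n
      using decseqD[OF decseq_closure that] unfolding W_def by blast
    have "W r s \<noteq> {}" for r
    proof -
      \<comment> \<open>A later round using the recurring set has a witness, which by nestedness
        also serves round \<open>r\<close>.\<close>
      obtain n where "r \<le> n" "f n = f r0"
        using inf unfolding infinite_nat_iff_unbounded_le by auto
      then show ?thesis using f(2)[of s n] mono[of r n] s by auto
    qed
    moreover have "compact (W r s)" for r
      unfolding W_def
      using compact_convex_closure closed_scenario_set closed_halfspace_le
      by (blast intro: compact_Int_closed)
    ultimately have "(\<Inter>r. W r s) \<noteq> {}"
      using mono by (intro compact_nest)
    then show ?thesis unfolding W_def by auto
  qed
  then show ?thesis using f(1) by blast
qed

lemma limit_eq: "(\<Inter>r. clo r) = convex hull feas"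
proof
  show "convex hull feas \<subseteq> (\<Inter>r. clo r)"
    using feasible_subset_closure compact_convex_closure
    by (intro hull_minimal convex_INT) auto
  show "(\<Inter>r. clo r) \<subseteq> convex hull feas"
  proof (rule ccontr)
    assume "\<not> (\<Inter>r. clo r) \<subseteq> convex hull feas"
    then obtain x where x: "x \<in> (\<Inter>r. clo r)" "x \<notin> convex hull feas" by blast
    obtain c where c: "\<And>u. u \<in> convex hull feas \<Longrightarrow> dist c u < dist c x"
      using ball_separating_point_from_convex_compact[OF convex_convex_hull _ x(2)]
        compact_convex_hull[OF compact_quantile_feasible[OF compact_X]] by blast
    have "compact (\<Inter>r. clo r)"
      using compact_convex_closure by (intro compact_Inter) auto
    moreover have "(\<Inter>r. clo r) \<noteq> {}" using x(1) by blast
    ultimately obtain y where y: "y \<in> (\<Inter>r. clo r)" "\<And>w. w \<in> (\<Inter>r. clo r) \<Longrightarrow> dist c w \<le> dist c y"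
      using distance_attains_sup[of "\<Inter>r. clo r" c] by metis
    \<comment> \<open>The direction \<open>c - y\<close> is the one for which the farthest point
      \<open>y\<close> is the only minimiser.\<close>
    obtain S where S: "S \<in> feasible_scenario_sets N p"
      "\<forall>s\<in>S. \<exists>w\<in>(\<Inter>r. clo r) \<inter> scen s. (c - y) \<bullet> w \<le> (c - y) \<bullet> y"
      using limit_fixed_point[OF y(1)] by blast
    \<comment> \<open>Every witness \<open>w\<close> coincides with \<open>y\<close>, so the
      witnesses, a priori different for each \<open>s\<close>, collapse to one point.\<close>
    have "y \<in> scen s" if "s \<in> S" for s
      using S(2) that farthest_point_unique_minimiser y(2) by (metis IntD1 IntD2)
    moreover have "y \<in> X" using y(1) by (metis INT_D UNIV_I quantile_closure.simps(1))
    ultimately have "y \<in> feas" using S(1) unfolding quantile_feasible_def by blast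
    then have "dist c y < dist c x" by (intro c hull_inc)
    then show False using y(2)[OF x(1)] by simp
  qed
qed

lemma hausdorff_tendsto_closure: "hausdorff_tendsto clo (convex hull feas)"
  using hausdorff_tendsto_nested_compact[of clo] compact_convex_closure decseq_closure limit_eq
  by simp

end

section \<open>The envelope set\<close>

text \<open>At most \<open>p\<close> lines exceed \<open>t\<close>, which settles
  \<open>t \<le> c\<close>; if instead \<open>c < t\<close>, the at least \<open>p + 1\<close> lines
  weakly above \<open>t\<close> all exceed \<open>c\<close>.\<close>

lemma envelope_le_iff:
  assumes "(z, t) \<in> upper_envelope om b N zd zu (p + 1)"
  shows "t \<le> c \<longleftrightarrow> card {s \<in> {1..N}. c < line om b s z} \<le> p"
proof
  assume "t \<le> c"
  then have "card {s \<in> {1..N}. c < line om b s z} \<le> card {s \<in> {1..N}. t < line om b s z}"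
    by (intro card_mono) auto
  then show "card {s \<in> {1..N}. c < line om b s z} \<le> p"
    using upper_envelope_scores(1)[OF assms] by (simp add: upper_score_def)
next
  assume le: "card {s \<in> {1..N}. c < line om b s z} \<le> p"
  show "t \<le> c"
  proof (rule ccontr)
    assume "\<not> t \<le> c"
    then have "card {s \<in> {1..N}. t \<le> line om b s z} \<le> card {s \<in> {1..N}. c < line om b s z}"
      by (intro card_mono) auto
    then show False using upper_envelope_scores(2)[OF assms] le by simp
  qed
qed

text \<open>The set of all \<open>s\<close> satisfying \<open>Q\<close> is the largest candidate,
  and its complement in \<open>{1..N}\<close> is what is counted.\<close>

lemma ex_feasible_scenario_set_iff:
  "(\<exists>S\<in>feasible_scenario_sets N p. \<forall>s\<in>S. Q s) \<longleftrightarrow> card {s \<in> {1..N}. \<not> Q s} \<le> p"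
proof -
  let ?G = "{s \<in> {1..N}. Q s}"
  have "card (?G \<union> {s \<in> {1..N}. \<not> Q s}) = card ?G + card {s \<in> {1..N}. \<not> Q s}"
    by (intro card_Un_disjoint) auto
  moreover have "?G \<union> {s \<in> {1..N}. \<not> Q s} = {1..N}" by auto
  ultimately have N: "N = card ?G + card {s \<in> {1..N}. \<not> Q s}" by simp
  have "(\<exists>S\<in>feasible_scenario_sets N p. \<forall>s\<in>S. Q s) \<longleftrightarrow> ?G \<in> feasible_scenario_sets N p"
  proof
    assume "\<exists>S\<in>feasible_scenario_sets N p. \<forall>s\<in>S. Q s"
    then obtain S where S: "S \<in> feasible_scenario_sets N p" "S \<subseteq> ?G"
      unfolding feasible_scenario_sets_def by blast
    then have "card S \<le> card ?G" by (intro card_mono) auto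
    then show "?G \<in> feasible_scenario_sets N p"
      using S(1) unfolding feasible_scenario_sets_def by auto
  next
    assume "?G \<in> feasible_scenario_sets N p"
    then show "\<exists>S\<in>feasible_scenario_sets N p. \<forall>s\<in>S. Q s" by (rule bexI[rotated]) simp
  qed
  also have "\<dots> \<longleftrightarrow> card {s \<in> {1..N}. \<not> Q s} \<le> p"
    using N unfolding feasible_scenario_sets_def by auto
  finally show ?thesis .
qed

lemma envelope_set_eq_quantile_feasible:
  assumes "compact X"
    and "is_graph_on (upper_envelope om b N (z_down ah X) (z_up ah X) (p + 1))
           {z_down ah X..z_up ah X}"
  shows "envelope_set a0 ah om b N p X = quantile_feasible a0 ah om b N p X"
proof -
  have "envelope_value om b N (z_down ah X) (z_up ah X) (p + 1) (ah \<bullet> x) \<le> - (x \<bullet> a0)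
          \<longleftrightarrow> (\<exists>S\<in>feasible_scenario_sets N p. \<forall>s\<in>S. x \<in> scenario_set a0 ah om b s)"
    if x: "x \<in> X" for x
  proof -
    have "compact ((\<lambda>x. ah \<bullet> x) ` X)"
      using assms(1) by (intro compact_continuous_image continuous_intros)
    then have "bounded ((\<lambda>x. ah \<bullet> x) ` X)" by (rule compact_imp_bounded)
    \<comment> \<open>Needed to apply the graph hypothesis at this abscissa, which ensures that
      \<open>envelope_value\<close> denotes a point of the envelope.\<close>
    then have "ah \<bullet> x \<in> {z_down ah X..z_up ah X}"
      unfolding z_down_def z_up_def
      using x by (auto intro: cINF_lower cSUP_upper bounded_imp_bdd_below bounded_imp_bdd_above)
    then have "\<exists>!t. (ah \<bullet> x, t) \<in> upper_envelope om b N (z_down ah X) (z_up ah X) (p + 1)"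
      using assms(2) unfolding is_graph_on_def by blast
    then have "(ah \<bullet> x, envelope_value om b N (z_down ah X) (z_up ah X) (p + 1) (ah \<bullet> x))
        \<in> upper_envelope om b N (z_down ah X) (z_up ah X) (p + 1)"
      unfolding envelope_value_def by (rule theI')
    \<comment> \<open>With \<open>c = - (x \<bullet> a0)\<close>, the lines counted in
      \<open>envelope_le_iff\<close> are exactly the violated scenarios.\<close>
    moreover have "- (x \<bullet> a0) < line om b s (ah \<bullet> x) \<longleftrightarrow> x \<notin> scenario_set a0 ah om b s" for s
      by (auto simp: line_def scenario_set_def)
    ultimately show ?thesis
      by (simp only: envelope_le_iff ex_feasible_scenario_set_iff)
  qed
  then show ?thesis unfolding envelope_set_def quantile_feasible_def by auto
qed

theorem corollaryA12:
  fixes X :: "(real^'i) set"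
    and a0 ahat :: "'j::finite \<Rightarrow> real^'i"
    and \<Omega> b :: "'j \<Rightarrow> nat \<Rightarrow> real"
    and N p :: nat
    and \<epsilon> :: real
    and j :: 'j
  assumes "X \<noteq> {}" and "compact X" and "convex X"
    and "1 \<le> N"
    and "0 < \<epsilon>" and "\<epsilon> < 1"
    and "p = nat \<lfloor>\<epsilon> * real N\<rfloor>"
    and "is_graph_on (upper_envelope (\<Omega> j) (b j) N (z_down (ahat j) X) (z_up (ahat j) X) (p + 1))
           {z_down (ahat j) X..z_up (ahat j) X}"
  shows "let U = envelope_set (a0 j) (ahat j) (\<Omega> j) (b j) N p X;
             Xr = quantile_closure (a0 j) (ahat j) (\<Omega> j) (b j) N p X
         in hausdorff_convergent Xr \<and> U \<subseteq> convex hull U \<and> convex hull U = hausdorff_lim Xr"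
proof -
  \<comment> \<open>Strictness of \<open>\<epsilon> < 1\<close> together with
    \<open>1 \<le> N\<close> yields the \<open>p < N\<close> required by the locale.\<close>
  have "\<epsilon> * real N < real N" using assms by simp
  then have "\<lfloor>\<epsilon> * real N\<rfloor> < int N" by (simp add: floor_less_iff)
  then have "p < N" using assms by (simp add: nat_less_iff)
  then interpret quantile_row "a0 j" "ahat j" "\<Omega> j" "b j" N p X
    using assms by unfold_locales
  have "envelope_set (a0 j) (ahat j) (\<Omega> j) (b j) N p X = feas"
    using assms by (intro envelope_set_eq_quantile_feasible)
  then show ?thesis
    using hausdorff_tendsto_closure hausdorff_lim_eq[OF hausdorff_tendsto_closure]
    by (auto simp: Let_def hausdorff_convergent_def hull_inc)
qed

end
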